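(* There is an absolute constant $C>0$ such that the following holds. Let $N\ge 1$ be an integer and let $z_{ij}\in\mathbb{C}$ for $0\le i,j<N$. Suppose the function $f:\mathbb{R}^2\to\mathbb{C}$ is zero outside the square $[0,N]\times[0,N]$ and is constant and equal to $z_{ij}$ on each of the squares $(i,j)+[0,1)^2$, $0\le i,j<N$. Then there is a straight line $S\subset\mathbb{R}^2$ such that $$\left|\int_S f\right|\ \ge\ C\,N^{-1/2}\left(\sum_{i,j=0}^{N-1}|z_{ij}|^2\right)^{1/2}.$$
   Context: The integral $\int_S f$ is taken with respect to arc length (one-dimensional Lebesgue measure) along the line $S$. The constant $C$ is absolute: it does not depend on $N$, on the numbers $z_{ij}$, or on $f$. *)

theory Defs
  imports "HOL-Analysis.Analysis"
begin

definition line_at :: "real \<times> real \<Rightarrow> real \<times> real \<Rightarrow> (real \<times> real) set" where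
  "line_at p u = range (\<lambda>t::real. p + t *\<^sub>R u)"

definition straight_line :: "(real \<times> real) set \<Rightarrow> bool" where
  "straight_line S \<longleftrightarrow> (\<exists>p u. norm u = 1 \<and> S = line_at p u)"

(* The integral with respect to arc length: S is parametrized by arc length as p + t u with
   u a Euclidean unit vector, and one integrates over the parameter. The lemma
   line_integral_eq below shows that the value is the same for every such parametrization.
   As usual for the Bochner integral, the value is 0 if f is not integrable along S. *)
definition line_integral :: "(real \<times> real) set \<Rightarrow> (real \<times> real \<Rightarrow> complex) \<Rightarrow> complex" where
  "line_integral S f =
     (THE I. \<forall>p u. norm u = 1 \<and> S = line_at p u \<longrightarrow> I = (LINT t|lebesgue. f (p + t *\<^sub>R u)))"

lemma line_at_reparam:
  assumes "norm u = 1" "norm v = 1" "line_at p u = line_at q v"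
  obtains s c where "c = 1 \<or> c = - 1" "q = p + s *\<^sub>R u" "v = c *\<^sub>R u"
proof -
  have on_line: "\<exists>t. q + r *\<^sub>R v = p + t *\<^sub>R u" for r
  proof -
    have "q + r *\<^sub>R v \<in> line_at p u"
      unfolding assms(3) unfolding line_at_def by (rule rangeI)
    then show ?thesis
      unfolding line_at_def by (rule rangeE) blast
  qed
  obtain s t where s: "q = p + s *\<^sub>R u" and t: "q + v = p + t *\<^sub>R u"
    using on_line[of 0] on_line[of 1] unfolding scaleR_zero_left scaleR_one add_0_right by blast
  have v: "v = (t - s) *\<^sub>R u"
    using s t unfolding scaleR_left_diff_distrib by (metis add_diff_cancel_left add_diff_cancel_left')
  then have "\<bar>t - s\<bar> = 1"
    using assms by simp
  then show ?thesis
    using that[of "t - s" s] s v by linarith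
qed

lemma line_integral_eq:
  assumes "norm u = 1"
  shows "line_integral (line_at p u) f = (LINT t|lebesgue. f (p + t *\<^sub>R u))"
  unfolding line_integral_def
proof (rule the_equality)
  show "\<forall>q v. norm v = 1 \<and> line_at p u = line_at q v \<longrightarrow>
      (LINT t|lebesgue. f (p + t *\<^sub>R u)) = (LINT t|lebesgue. f (q + t *\<^sub>R v))"
  proof (intro allI impI, elim conjE)
    fix q v assume "norm v = 1" "line_at p u = line_at q v"
    with assms obtain s c where c: "c = 1 \<or> c = - 1" and q: "q = p + s *\<^sub>R u"
      and v: "v = c *\<^sub>R u"
      by (rule line_at_reparam)
    have "(LINT t|lebesgue. f (p + t *\<^sub>R u)) =
        \<bar>c\<bar> *\<^sub>R (LINT t|lebesgue. f (p + (s + c * t) *\<^sub>R u))"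
      using c by (intro lebesgue_integral_real_affine) auto
    also have "\<dots> = (LINT t|lebesgue. f (q + t *\<^sub>R v))"
      using c by (auto simp: q v algebra_simps)
    finally show "(LINT t|lebesgue. f (p + t *\<^sub>R u)) = (LINT t|lebesgue. f (q + t *\<^sub>R v))" .
  qed
qed (use assms in blast)

end

theory Submission
  imports Defs
begin

text \<open>The idea is to average the squared line integrals over all lines. Write \<open>F\<close> for the Fourier transform
of \<open>f\<close>. The average over all directions weights \<open>\<bar>F \<xi>\<bar>\<^sup>2\<close> by \<open>1 / \<bar>\<xi>\<bar>\<close>, which is bounded below on a
bounded set of frequencies, while the lines meeting the square form a set of measure of order \<open>N\<close>.
Hence, up to a constant, \<open>N M\<^sup>2\<close> dominates the integral of \<open>\<bar>F\<bar>\<^sup>2\<close> over the frequency square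
\<open>[-1/2, 1/2]\<^sup>2\<close>, where \<open>M\<close> is the supremum of the moduli of the line integrals. For a function that is
constant on unit cells, \<open>F\<close> is the trigonometric polynomial with coefficients \<open>z i j\<close> times the
transform of the unit square. The latter factor is bounded away from zero on the frequency square,
and that square is a full period of the polynomial. So, by Parseval, the integral is at least a
constant times the sum of the \<open>\<bar>z i j\<bar>\<^sup>2\<close>.

Directions are parametrized by slope instead of angle. The lines \<open>x + m y = s\<close> with \<open>\<bar>m\<bar> \<le> 1\<close> see
the frequencies \<open>(\<sigma>, m \<sigma>)\<close> (\<open>fourier_slice\<close>), hence the cone \<open>\<bar>\<beta>\<bar> \<le> \<bar>\<alpha>\<bar>\<close>; the substitution
\<open>\<beta> = m \<alpha>\<close> has Jacobian \<open>\<bar>\<alpha>\<bar>\<close>, whose boundedness by \<open>1/2\<close> is the lower bound on the weight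
(\<open>nn_integral_trig_poly_on_cone_le\<close>). The complementary cone is obtained by exchanging the two
coordinates, and the two cones together cover the frequency square (\<open>sum_norm_pixels_le\<close>).

For a fixed slope, the projection is bounded by \<open>M\<close> and lives on an interval of length \<open>L = 3 N\<close>.
Instead of Plancherel on the line it suffices to use Bessel's inequality (\<open>bessel_period\<close>) for the
frequencies in a translate of the lattice \<open>\<int> / L\<close>, and to average over all translates.\<close>

section \<open>Exponentials and orthogonality on a period\<close>

definition phase :: "real \<Rightarrow> complex" where
  "phase x = cis (2 * pi * x)"

lemma phase_0 [simp]: "phase 0 = 1"
  by (simp add: phase_def)

lemma phase_add: "phase (x + y) = phase x * phase y"
  by (simp add: phase_def cis_mult distrib_left)

lemma cnj_phase: "cnj (phase x) = phase (- x)"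
  by (simp add: phase_def cis_cnj)

lemma norm_phase [simp]: "cmod (phase x) = 1"
  by (simp add: phase_def)

lemma phase_of_int [simp]: "phase (of_int k) = 1"
  by (simp add: phase_def cis_multiple_2pi)

lemma continuous_on_phase [continuous_intros]:
  "continuous_on A f \<Longrightarrow> continuous_on A (\<lambda>x. phase (f x))"
  unfolding phase_def by (intro continuous_intros)

lemma borel_measurable_phase [measurable]: "phase \<in> borel_measurable borel"
  by (intro borel_measurable_continuous_onI continuous_intros)

lemma has_bochner_integral_mono_AE:
  fixes f g :: "'a \<Rightarrow> real"
  assumes "has_bochner_integral M f x" "has_bochner_integral M g y" "AE s in M. f s \<le> g s"
  shows "x \<le> y"
  using assms integral_mono_AE[of M f g] by (simp add: has_bochner_integral_iff)

text \<open>The orthogonality relations: an exponential with period dividing \<open>L\<close> has an antiderivative with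
the same period, unless it is constant.\<close>
lemma integral_phase_period:
  fixes A L :: real and k :: int
  assumes "L > 0"
  shows "has_bochner_integral lborel (\<lambda>s. indicator {A..A + L} s *\<^sub>R phase (of_int k * s / L))
    (if k = 0 then of_real L else 0)"
proof (cases "k = 0")
  case True
  have "has_bochner_integral lborel (\<lambda>s. indicator {A..A + L} s :: real) L"
    using assms has_bochner_integral_real_indicator[of "{A..A + L}" lborel] by simp
  from has_bochner_integral_of_real[OF this, where 'a=complex] True show ?thesis
    by (simp add: scaleR_conv_of_real)
next
  case False
  define F where "F s = phase (of_int k * s / L) * (of_real L / (2 * pi * of_int k * \<i>))" for s
  have dphase: "(phase has_vector_derivative (2 * pi * \<i>) * phase x) (at x)" for x
  proof -
    have "((\<lambda>w. exp (2 * pi * \<i> * w)) has_field_derivative (2 * pi * \<i>) * exp (2 * pi * \<i> * of_real x))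
        (at (of_real x))"
      by (auto intro!: derivative_eq_intros)
    note d = has_vector_derivative_real_field[OF this, of UNIV]
    have "phase = (\<lambda>x. exp (2 * pi * \<i> * of_real x))"
      by (simp add: phase_def cis_conv_exp fun_eq_iff mult_ac)
    show ?thesis
      unfolding \<open>phase = _\<close> using d by simp
  qed
  have "((\<lambda>s. phase (of_int k * s / L)) has_vector_derivative
      (of_int k / L) *\<^sub>R ((2 * pi * \<i>) * phase (of_int k * s / L))) (at s within B)" for s B
    by (rule vector_diff_chain_within[where f="\<lambda>s. of_int k * s / L" and g=phase, unfolded o_def])
       (use assms in \<open>auto intro!: derivative_eq_intros
          intro: has_vector_derivative_at_within[OF dphase, simplified]
          simp: has_real_derivative_iff_has_vector_derivative[symmetric]\<close>)
  note d = has_vector_derivative_mult_left[OF this]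
  have "(F has_vector_derivative phase (of_int k * s / L)) (at s within B)" for s B
    unfolding F_def
    by (rule has_vector_derivative_eq_rhs[OF d]) (use assms False in \<open>auto simp: field_simps scaleR_conv_of_real\<close>)
  then have "has_bochner_integral lborel (\<lambda>s. indicator {A..A + L} s *\<^sub>R phase (of_int k * s / L))
      (F (A + L) - F A)"
    using assms by (intro has_bochner_integral_FTC_Icc continuous_intros) auto
  moreover have "of_int k * (A + L) / L = of_int k * A / L + of_int k"
    using assms by (simp add: field_simps)
  then have "F (A + L) = F A"
    by (simp add: F_def phase_add)
  ultimately show ?thesis
    using False by simp
qed

lemma parseval_period:
  fixes A L :: real and c :: "nat \<Rightarrow> complex"
  assumes "L > 0"
  shows "has_bochner_integral lborel
    (\<lambda>s. indicator {A..A + L} s * (cmod (\<Sum>a<n. c a * phase (real a * s / L)))\<^sup>2)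
    (L * (\<Sum>a<n. (cmod (c a))\<^sup>2))"
proof -
  have expand: "of_real (indicator {A..A + L} s * (cmod (\<Sum>a<n. c a * phase (real a * s / L)))\<^sup>2) =
      (\<Sum>a<n. \<Sum>b<n. c a * cnj (c b) *
        (indicator {A..A + L} s *\<^sub>R phase (of_int (int a - int b) * s / L)))" for s
  proof -
    have "phase (of_int (int a - int b) * s / L) = phase (real a * s / L) * cnj (phase (real b * s / L))" for a b
      by (simp add: cnj_phase phase_add[symmetric] diff_divide_distrib algebra_simps)
    then show ?thesis
      unfolding of_real_mult complex_norm_square
      by (simp add: sum_product sum_distrib_left scaleR_conv_of_real mult_ac) (rule sum.swap)
  qed
  have "has_bochner_integral lborel
      (\<lambda>s. of_real (indicator {A..A + L} s * (cmod (\<Sum>a<n. c a * phase (real a * s / L)))\<^sup>2))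
      (\<Sum>a<n. \<Sum>b<n. c a * cnj (c b) * (if int a - int b = 0 then of_real L else 0))"
    unfolding expand
    by (intro has_bochner_integral_sum has_bochner_integral_mult_right integral_phase_period assms)
  also have "(\<Sum>a<n. \<Sum>b<n. c a * cnj (c b) * (if int a - int b = 0 then of_real L else 0)) =
      (\<Sum>a<n. c a * cnj (c a) * of_real L)"
    by (auto intro!: sum.cong simp: if_distrib cong: if_cong)
  also have "\<dots> = of_real (L * (\<Sum>a<n. (cmod (c a))\<^sup>2))"
    by (simp only: of_real_mult of_real_sum complex_norm_square sum_distrib_left mult.commute)
  finally have "has_bochner_integral lborel
      (\<lambda>s. complex_of_real (indicator {A..A + L} s * (cmod (\<Sum>a<n. c a * phase (real a * s / L)))\<^sup>2))
      (of_real (L * (\<Sum>a<n. (cmod (c a))\<^sup>2)))" .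
  from has_bochner_integral_Re[OF this] show ?thesis by simp
qed

text \<open>Bessel's inequality, in a form that uses only a pointwise bound on \<open>g\<close>. With \<open>T\<close> the exponential
sum whose coefficients are the conjugated Fourier coefficients of \<open>g\<close>, the integral of \<open>g T\<close> and
\<open>1 / L\<close> times that of \<open>|T|^2\<close> both equal the sum \<open>S\<close> of the squared coefficients, so integrating
\<open>2 Re (g T) / L \<le> M^2 + |T|^2 / L^2\<close> over the period bounds \<open>S\<close>. The shift \<open>\<kappa>\<close> multiplies all
exponentials by the same unimodular function and does not affect their orthogonality.\<close>
lemma bessel_period:
  fixes g :: "real \<Rightarrow> complex" and A L M \<kappa> :: real
  assumes L: "L > 0" and g [measurable]: "g \<in> borel_measurable borel"
    and bound: "\<And>s. cmod (g s) \<le> M" and support: "\<And>s. s \<notin> {A..A + L} \<Longrightarrow> g s = 0"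
  shows "(\<Sum>a<n. (cmod (LINT s|lborel. g s * phase ((\<kappa> + real a / L) * s)))\<^sup>2) \<le> L\<^sup>2 * M\<^sup>2"
proof -
  define \<phi> where "\<phi> a s = phase ((\<kappa> + real a / L) * s)" for a s
  define c where "c a = (LINT s|lborel. g s * \<phi> a s)" for a
  define T where "T s = (\<Sum>a<n. cnj (c a) * \<phi> a s)" for s
  define S where "S = (\<Sum>a<n. (cmod (c a))\<^sup>2)"
  have [measurable]: "\<phi> a \<in> borel_measurable borel" for a
    unfolding \<phi>_def by measurable
  have int_g: "integrable lborel (\<lambda>s. g s * \<phi> a s)" for a
    by (rule integrableI_bounded_set[of "{A..A + L}" _ _ M])
       (use L in \<open>auto simp: \<phi>_def norm_mult bound support\<close>)
  have "has_bochner_integral lborel (\<lambda>s. \<Sum>a<n. cnj (c a) * (g s * \<phi> a s)) (\<Sum>a<n. cnj (c a) * c a)"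
    unfolding c_def
    by (intro has_bochner_integral_sum has_bochner_integral_mult_right has_bochner_integral_integrable int_g)
  moreover have "(\<Sum>a<n. cnj (c a) * c a) = of_real S"
    by (simp only: S_def of_real_sum complex_norm_square mult.commute)
  ultimately have "has_bochner_integral lborel (\<lambda>s. g s * T s) (of_real S)"
    by (simp add: T_def sum_distrib_left mult_ac)
  from has_bochner_integral_Re[OF this]
  have gT: "has_bochner_integral lborel (\<lambda>s. Re (g s * T s)) S" by simp
  have "cmod (T s) = cmod (phase (\<kappa> * s) * (\<Sum>a<n. cnj (c a) * phase (real a * s / L)))" for s
    unfolding T_def \<phi>_def sum_distrib_left
    by (intro arg_cong[where f=cmod] sum.cong) (auto simp: phase_add distrib_right)
  then have T2: "has_bochner_integral lborel (\<lambda>s. indicator {A..A + L} s * (cmod (T s))\<^sup>2) (L * S)"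
    using parseval_period[OF L, of A "\<lambda>a. cnj (c a)" n] by (simp add: norm_mult S_def)
  have M2: "has_bochner_integral lborel (\<lambda>s. indicator {A..A + L} s * M\<^sup>2) (L * M\<^sup>2)"
    using L has_bochner_integral_real_indicator[of "{A..A + L}" lborel]
    by (intro has_bochner_integral_mult_left) auto
  have "2 / L * S \<le> L * M\<^sup>2 + 1 / L\<^sup>2 * (L * S)"
  proof (rule has_bochner_integral_mono_AE)
    show "has_bochner_integral lborel (\<lambda>s. 2 / L * Re (g s * T s)) (2 / L * S)"
      by (intro has_bochner_integral_mult_right gT)
    show "has_bochner_integral lborel (\<lambda>s. indicator {A..A + L} s * M\<^sup>2 +
        1 / L\<^sup>2 * (indicator {A..A + L} s * (cmod (T s))\<^sup>2)) (L * M\<^sup>2 + 1 / L\<^sup>2 * (L * S))"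
      by (intro has_bochner_integral_add has_bochner_integral_mult_right M2 T2)
    have "2 / L * Re (g s * T s) \<le> indicator {A..A + L} s * M\<^sup>2 +
        1 / L\<^sup>2 * (indicator {A..A + L} s * (cmod (T s))\<^sup>2)" for s
    proof (cases "s \<in> {A..A + L}")
      case True
      have "2 / L * Re (g s * T s) \<le> 2 / L * (M * cmod (T s))"
        using complex_Re_le_cmod[of "g s * T s"] mult_right_mono[OF bound[of s], of "cmod (T s)"] L
        by (intro mult_left_mono) (auto simp: norm_mult)
      also have "\<dots> = 2 * M * (cmod (T s) / L)"
        by simp
      also have "\<dots> \<le> M\<^sup>2 + (cmod (T s) / L)\<^sup>2"
        by (rule sum_squares_bound)
      finally show ?thesis using True by (simp add: power_divide)
    qed (simp add: support)
    then show "AE s in lborel. 2 / L * Re (g s * T s) \<le> indicator {A..A + L} s * M\<^sup>2 +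
        1 / L\<^sup>2 * (indicator {A..A + L} s * (cmod (T s))\<^sup>2)"
      by simp
  qed
  then have "S \<le> L\<^sup>2 * M\<^sup>2"
    using L by (simp add: field_simps power2_eq_square)
  then show ?thesis
    by (simp add: S_def c_def \<phi>_def)
qed

section \<open>The Fourier slice theorem\<close>

text \<open>The integral over the line \<open>x + m y = s\<close> with the second coordinate as parameter. It is
\<open>sqrt (1 + m^2)\<close> times smaller than the integral by arc length; in exchange everything
depends on \<open>s\<close> and \<open>m\<close> through affine maps.\<close>
definition shear_proj :: "(real \<times> real \<Rightarrow> complex) \<Rightarrow> real \<Rightarrow> real \<Rightarrow> complex" where
  "shear_proj F m s = (LINT t|lborel. F (s - m * t, t))"

lemma borel_measurable_shear_proj [measurable]:
  assumes "F \<in> borel_measurable borel"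
  shows "shear_proj F m \<in> borel_measurable borel"
proof -
  have [measurable]: "F \<in> borel_measurable (borel \<Otimes>\<^sub>M borel)"
    using assms by (simp add: borel_prod)
  have "(\<lambda>s. LINT t|lborel. F (s - m * t, t)) \<in> borel_measurable borel"
    by measurable
  then show ?thesis
    by (simp add: shear_proj_def[abs_def])
qed

text \<open>By Fubini, integrating the projection against \<open>phase (\<sigma> * s)\<close> amounts to integrating \<open>F\<close>
against the plane wave of frequency \<open>(\<sigma>, m \<sigma>)\<close>, as \<open>s = x + m y\<close> on the line.\<close>
lemma fourier_slice:
  fixes F :: "real \<times> real \<Rightarrow> complex"
  assumes F: "F \<in> borel_measurable borel" and bound: "\<And>p. cmod (F p) \<le> B"
    and support: "\<And>p. p \<notin> {0..R} \<times> {0..R} \<Longrightarrow> F p = 0"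
  shows "(LINT s|lborel. shear_proj F m s * phase (\<sigma> * s)) =
    (LINT t|lborel. LINT x|lborel. F (x, t) * phase (\<sigma> * (x + m * t)))"
proof -
  have [measurable]: "F \<in> borel_measurable (borel \<Otimes>\<^sub>M borel)"
    using F by (simp add: borel_prod)
  define K where "K = cbox (- (\<bar>m\<bar> * R), 0) (R + \<bar>m\<bar> * R, R)"
  have "integrable (lborel \<Otimes>\<^sub>M lborel) (\<lambda>(s, t). F (s - m * t, t) * phase (\<sigma> * s))"
  proof (rule integrableI_bounded_set[of K _ _ B])
    show "K \<in> sets (lborel \<Otimes>\<^sub>M lborel)" "emeasure (lborel \<Otimes>\<^sub>M lborel) K < \<infinity>"
      unfolding K_def lborel_prod by (auto simp: emeasure_lborel_cbox_eq)
    have "F (s - m * t, t) = 0" if "(s, t) \<notin> K" for s t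
    proof (rule support, rule notI)
      assume st: "(s - m * t, t) \<in> {0..R} \<times> {0..R}"
      then have "\<bar>m * t\<bar> \<le> \<bar>m\<bar> * R"
        by (auto simp: abs_mult intro!: mult_left_mono)
      with st have "(s, t) \<in> K"
        by (auto simp: K_def cbox_Pair_eq)
      with that show False by simp
    qed
    then show "AE p in lborel \<Otimes>\<^sub>M lborel. p \<notin> K \<longrightarrow> (case p of (s, t) \<Rightarrow> F (s - m * t, t) * phase (\<sigma> * s)) = 0"
      by (intro AE_I2) auto
  qed (auto simp: norm_mult bound)
  from lborel_pair.Fubini_integral[OF this]
  have "(LINT s|lborel. LINT t|lborel. F (s - m * t, t) * phase (\<sigma> * s)) =
      (LINT t|lborel. LINT s|lborel. F (s - m * t, t) * phase (\<sigma> * s))" ..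
  moreover have "(LINT s|lborel. F (s - m * t, t) * phase (\<sigma> * s)) =
      (LINT x|lborel. F (x, t) * phase (\<sigma> * (x + m * t)))" for t
    by (subst lborel_integral_real_affine[where c=1 and t="m * t"]) (simp_all add: add.commute)
  ultimately show ?thesis
    by (simp add: shear_proj_def)
qed

section \<open>Functions that are constant on unit cells\<close>

text \<open>The version of the step function that vanishes on the upper and right edges of the square, where the
values of the function in the theorem are arbitrary.\<close>
definition pixel_fun :: "nat \<Rightarrow> (nat \<Rightarrow> nat \<Rightarrow> complex) \<Rightarrow> real \<times> real \<Rightarrow> complex" where
  "pixel_fun N z p = (\<Sum>i<N. \<Sum>j<N. z i j *
     indicator {real i..<real i + 1} (fst p) * indicator {real j..<real j + 1} (snd p))"

lemma borel_measurable_pixel_fun [measurable]: "pixel_fun N z \<in> borel_measurable borel"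
proof -
  have "pixel_fun N z \<in> borel_measurable (borel \<Otimes>\<^sub>M borel)"
    unfolding pixel_fun_def[abs_def] by measurable
  then show ?thesis
    by (simp add: borel_prod)
qed

lemma indicator_unit_cell:
  fixes x :: real
  assumes "0 \<le> x"
  shows "indicator {real i..<real i + 1} x = (if i = nat \<lfloor>x\<rfloor> then 1 else 0 :: 'a::zero_neq_one)"
  using assms by (auto simp: indicator_def le_nat_floor) linarith+

lemma pixel_fun_cell:
  assumes "i < N" "j < N" "p \<in> {real i..<real i + 1} \<times> {real j..<real j + 1}"
  shows "pixel_fun N z p = z i j"
proof -
  have "nat \<lfloor>fst p\<rfloor> = i" "nat \<lfloor>snd p\<rfloor> = j" "0 \<le> fst p" "0 \<le> snd p"
    using assms by (auto; linarith)+
  then have "pixel_fun N z p = (\<Sum>i'<N. if i' = i then \<Sum>j'<N. if j' = j then z i j' else 0 else 0)"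
    unfolding pixel_fun_def by (intro sum.cong) (auto simp: indicator_unit_cell mult_delta_right)
  also have "\<dots> = z i j"
    using assms(1,2) by simp
  finally show ?thesis .
qed

lemma pixel_fun_outside:
  assumes "p \<notin> {0..<real N} \<times> {0..<real N}"
  shows "pixel_fun N z p = 0"
  unfolding pixel_fun_def
proof (intro sum.neutral ballI)
  fix i j assume "i \<in> {..<N}" "j \<in> {..<N}"
  then have "real i + 1 \<le> real N" "real j + 1 \<le> real N" by auto
  with assms show "z i j * indicator {real i..<real i + 1} (fst p) *
      indicator {real j..<real j + 1} (snd p) = 0"
    by (cases p) (auto simp: indicator_def)
qed

lemma in_some_cell:
  assumes "0 \<le> x" "x < real N"
  obtains i where "i < N" "x \<in> {real i..<real i + 1}"
proof
  have "real (nat \<lfloor>x\<rfloor>) = of_int \<lfloor>x\<rfloor>"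
    using assms by simp
  then show "nat \<lfloor>x\<rfloor> < N" "x \<in> {real (nat \<lfloor>x\<rfloor>)..<real (nat \<lfloor>x\<rfloor>) + 1}"
    using assms by (simp_all, linarith+)
qed

lemma norm_pixel_fun_le: "cmod (pixel_fun N z p) \<le> (\<Sum>i<N. \<Sum>j<N. cmod (z i j))"
  unfolding pixel_fun_def
  by (intro norm_sum[THEN order_trans] sum_mono) (auto simp: norm_mult indicator_def)

text \<open>The projections live on an interval of length \<open>3 N\<close>, since \<open>s = x + m y\<close> with \<open>x\<close> and \<open>y\<close>
between \<open>0\<close> and \<open>N\<close>.\<close>
lemma shear_proj_pixel_fun_outside:
  assumes "\<bar>m\<bar> \<le> 1" "s \<notin> {- real N..2 * real N}"
  shows "shear_proj (pixel_fun N z) m s = 0"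
proof -
  have "pixel_fun N z (s - m * t, t) = 0" for t
  proof (rule pixel_fun_outside, rule notI)
    assume st: "(s - m * t, t) \<in> {0..<real N} \<times> {0..<real N}"
    with assms(1) have "\<bar>m * t\<bar> \<le> 1 * real N"
      unfolding abs_mult by (intro mult_mono) auto
    with st assms(2) show False by auto
  qed
  then show ?thesis by (simp add: shear_proj_def)
qed

text \<open>The Fourier transform of the point masses \<open>z i j\<close> at the lattice points. Its product with two values
of \<open>cell_factor\<close>, the transform of the unit interval, is the transform of \<open>pixel_fun\<close>.\<close>
definition trig_poly :: "nat \<Rightarrow> (nat \<Rightarrow> nat \<Rightarrow> complex) \<Rightarrow> real \<Rightarrow> real \<Rightarrow> complex" where
  "trig_poly N z \<alpha> \<beta> = (\<Sum>i<N. \<Sum>j<N. z i j * phase (\<alpha> * real i + \<beta> * real j))"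

definition cell_factor :: "real \<Rightarrow> complex" where
  "cell_factor \<alpha> = (LINT x|lborel. indicator {0..<1} x * phase (\<alpha> * x))"

lemma integrable_cell: "integrable lborel (\<lambda>x. indicator {a..<a + 1} x * phase (\<alpha> * x + b))"
  by (rule integrableI_bounded_set[of "{a..<a + 1}" _ _ 1]) (auto simp: norm_mult)

lemma integral_cell:
  "(LINT x|lborel. indicator {real i..<real i + 1} x * phase (\<alpha> * x + b)) =
     phase (\<alpha> * real i + b) * cell_factor \<alpha>"
proof -
  have "indicator {real i..<real i + 1} (real i + 1 * x) * phase (\<alpha> * (real i + 1 * x) + b) =
      phase (\<alpha> * real i + b) * (indicator {0..<1} x * phase (\<alpha> * x))" for x
    by (auto simp: indicator_def phase_add distrib_left)
  then show ?thesis
    unfolding cell_factor_def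
    by (subst lborel_integral_real_affine[where c=1 and t="real i"]) simp_all
qed

lemma fourier_slice_pixel_fun:
  "(LINT s|lborel. shear_proj (pixel_fun N z) m s * phase (\<sigma> * s)) =
     trig_poly N z \<sigma> (\<sigma> * m) * cell_factor \<sigma> * cell_factor (\<sigma> * m)"
proof -
  have inner: "(LINT x|lborel. pixel_fun N z (x, t) * phase (\<sigma> * (x + m * t))) =
      (\<Sum>i<N. \<Sum>j<N. z i j * phase (\<sigma> * real i) * cell_factor \<sigma> *
        (indicator {real j..<real j + 1} t * phase (\<sigma> * m * t)))" for t
  proof -
    have "(LINT x|lborel. pixel_fun N z (x, t) * phase (\<sigma> * (x + m * t))) =
      (LINT x|lborel. (\<Sum>i<N. \<Sum>j<N. z i j * indicator {real j..<real j + 1} t *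
        (indicator {real i..<real i + 1} x * phase (\<sigma> * x + \<sigma> * m * t))))"
      by (simp add: pixel_fun_def sum_distrib_left sum_distrib_right mult_ac distrib_left)
    also have "\<dots> = (\<Sum>i<N. \<Sum>j<N. z i j * indicator {real j..<real j + 1} t *
        (phase (\<sigma> * real i + \<sigma> * m * t) * cell_factor \<sigma>))"
      by (subst Bochner_Integration.integral_sum Bochner_Integration.integrable_sum
            integral_mult_right_zero integral_cell;
          (intro Bochner_Integration.integrable_sum integrable_mult_right integrable_cell)?)+ simp
    finally show ?thesis
      by (simp add: phase_add mult_ac)
  qed
  have "(LINT s|lborel. shear_proj (pixel_fun N z) m s * phase (\<sigma> * s)) =
      (LINT t|lborel. LINT x|lborel. pixel_fun N z (x, t) * phase (\<sigma> * (x + m * t)))"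
    by (rule fourier_slice[OF borel_measurable_pixel_fun norm_pixel_fun_le, where R="real N"])
       (auto intro!: pixel_fun_outside)
  also have "\<dots> = (\<Sum>i<N. \<Sum>j<N. z i j * phase (\<sigma> * real i) * cell_factor \<sigma> *
      (phase (\<sigma> * m * real j + 0) * cell_factor (\<sigma> * m)))"
    unfolding inner
    using integrable_cell[of _ _ 0] integral_cell[of _ _ 0]
    by (simp add: Bochner_Integration.integral_sum)
  also have "\<dots> = trig_poly N z \<sigma> (\<sigma> * m) * cell_factor \<sigma> * cell_factor (\<sigma> * m)"
    by (simp add: trig_poly_def phase_add sum_distrib_left sum_distrib_right mult_ac)
  finally show ?thesis .
qed

lemma cos_ge_quadratic: "1 - x\<^sup>2 / 2 \<le> cos (x::real)"
proof -
  have "\<bar>sin (x / 2)\<bar> \<le> \<bar>x / 2\<bar>"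
    by (rule abs_sin_x_le_abs_x)
  then have "(sin (x / 2))\<^sup>2 \<le> (x / 2)\<^sup>2"
    by (simp only: abs_le_square_iff)
  then show ?thesis
    using cos_double_sin[of "x / 2"] by (simp add: power_divide)
qed

text \<open>After the unit interval is centred at the origin, only the cosine part contributes to the real part,
and \<open>cos x \<ge> 1 - x^2 / 2\<close> leaves \<open>1 - pi^2 \<alpha>^2 / 6\<close>. The bound fails for general \<open>\<alpha>\<close>: the factor
vanishes at nonzero integers, so the frequencies have to stay in the central period.\<close>
lemma norm_cell_factor_ge:
  assumes "\<bar>\<alpha>\<bar> \<le> 1 / 2"
  shows "1 / 2 \<le> cmod (cell_factor \<alpha>)"
proof -
  \<comment> \<open>chosen so that the quadratic minorant of the cosine is \<open>1 - c (x - 1/2)^2\<close>\<close>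
  define c where "c = 2 * pi\<^sup>2 * \<alpha>\<^sup>2"
  have "\<bar>\<alpha>\<bar>\<^sup>2 \<le> (1/2)\<^sup>2"
    using assms by (intro power_mono) auto
  moreover have "pi\<^sup>2 \<le> (3.2)\<^sup>2"
    using pi_approx by (intro power_mono) auto
  ultimately have "2 * (pi\<^sup>2 * \<alpha>\<^sup>2) \<le> 2 * ((3.2)\<^sup>2 * (1/2)\<^sup>2)"
    by (intro mult_left_mono mult_mono) auto
  then have c: "c \<le> 6"
    by (simp add: c_def power2_eq_square)
  have "has_bochner_integral lborel (\<lambda>x. indicator {0..1} x *\<^sub>R (1 - c * (x - 1/2)\<^sup>2))
      ((1 - c * (1 - 1/2)^3 / 3) - (0 - c * (0 - 1/2)^3 / 3))"
    by (rule has_bochner_integral_FTC_Icc[where F="\<lambda>x. x - c * (x - 1/2)^3 / 3"])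
       (auto intro!: derivative_eq_intros continuous_intros
         simp: has_real_derivative_iff_has_vector_derivative[symmetric] power2_eq_square)
  then have quad: "has_bochner_integral lborel (\<lambda>x. indicator {0..1} x *\<^sub>R (1 - c * (x - 1/2)\<^sup>2)) (1 - c / 12)"
    by (simp add: power3_eq_cube)
  have "has_bochner_integral lborel (\<lambda>x. indicator {0..<1} x * phase (\<alpha> * x)) (cell_factor \<alpha>)"
    unfolding cell_factor_def using integrable_cell[of 0 \<alpha> 0] by (simp add: has_bochner_integral_iff)
  then have "has_bochner_integral lborel (\<lambda>x. phase (- \<alpha> / 2) * (indicator {0..<1} x * phase (\<alpha> * x)))
      (phase (- \<alpha> / 2) * cell_factor \<alpha>)"
    by (rule has_bochner_integral_mult_right)
  from has_bochner_integral_Re[OF this]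
  have centred: "has_bochner_integral lborel (\<lambda>x. Re (phase (- \<alpha> / 2) * (indicator {0..<1} x * phase (\<alpha> * x))))
      (Re (phase (- \<alpha> / 2) * cell_factor \<alpha>))" .
  have "1 / 2 \<le> 1 - c / 12"
    using c by simp
  also have "\<dots> \<le> Re (phase (- \<alpha> / 2) * cell_factor \<alpha>)"
  proof (rule has_bochner_integral_mono_AE[OF quad centred])
    have "AE x in lborel. x \<noteq> (1::real)"
      by (rule AE_lborel_singleton)
    then show "AE x in lborel. indicator {0..1} x *\<^sub>R (1 - c * (x - 1/2)\<^sup>2) \<le>
        Re (phase (- \<alpha> / 2) * (indicator {0..<1} x * phase (\<alpha> * x)))"
    proof eventually_elim
      case (elim x)
      have "1 - c * (x - 1/2)\<^sup>2 \<le> cos (2 * pi * \<alpha> * (x - 1/2))"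
        using cos_ge_quadratic[of "2 * pi * \<alpha> * (x - 1/2)"]
        by (simp add: c_def power_mult_distrib)
      moreover have "phase (- \<alpha> / 2) * phase (\<alpha> * x) = phase (\<alpha> * (x - 1/2))"
        by (simp add: phase_add[symmetric] algebra_simps)
      then have "Re (phase (- \<alpha> / 2) * phase (\<alpha> * x)) = cos (2 * pi * \<alpha> * (x - 1/2))"
        by (simp add: phase_def mult_ac)
      ultimately show ?case
        using elim by (auto simp: indicator_def)
    qed
  qed
  also have "\<dots> \<le> cmod (cell_factor \<alpha>)"
    using complex_Re_le_cmod[of "phase (- \<alpha> / 2) * cell_factor \<alpha>"] by (simp add: norm_mult)
  finally show ?thesis .
qed

section \<open>Energy of the trigonometric polynomial along rays\<close>

text \<open>Bessel's inequality for one projection. The \<open>3 N\<close> frequencies \<open>\<sigma> a\<close> are spaced by \<open>1 / (3 N)\<close>,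
the reciprocal of the length of the support, and lie in \<open>[-1/2, 1/2]\<close>. Both \<open>\<sigma> a\<close> and \<open>\<sigma> a * m\<close> stay in
that interval, so the two cell factors cost at most a factor \<open>4\<close>, and \<open>144 = 4^2 * 3^2\<close>.\<close>
lemma sum_trig_poly_on_ray_le:
  assumes "1 \<le> N" and m: "\<bar>m\<bar> \<le> 1" and "0 \<le> \<tau>" "\<tau> < 1"
    and bound: "\<And>s. cmod (shear_proj (pixel_fun N z) m s) \<le> M"
  defines "\<sigma> \<equiv> \<lambda>a::nat. - 1 / 2 + (\<tau> + real a) / real (3 * N)"
  shows "(\<Sum>a<3 * N. (cmod (trig_poly N z (\<sigma> a) (\<sigma> a * m)))\<^sup>2) \<le> 144 * (real N)\<^sup>2 * M\<^sup>2"
proof -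
  define L where "L = real (3 * N)"
  have L: "L > 0" using assms(1) by (simp add: L_def)
  define G where "G a = (LINT s|lborel. shear_proj (pixel_fun N z) m s * phase (\<sigma> a * s))" for a
  have "(cmod (trig_poly N z (\<sigma> a) (\<sigma> a * m)))\<^sup>2 \<le> 16 * (cmod (G a))\<^sup>2" if "a < 3 * N" for a
  proof -
    have "real a + 1 \<le> L"
      using that unfolding L_def by linarith
    then have "0 \<le> (\<tau> + real a) / L" "(\<tau> + real a) / L \<le> 1"
      using assms(3,4) L by auto
    then have "\<bar>\<sigma> a\<bar> \<le> 1 / 2"
      unfolding \<sigma>_def L_def[symmetric] by linarith
    moreover from this have "\<bar>\<sigma> a * m\<bar> \<le> 1 / 2"
      using m mult_mono[of "\<bar>\<sigma> a\<bar>" "1/2" "\<bar>m\<bar>" 1] by (simp add: abs_mult)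
    ultimately have "1 / 2 * (1 / 2) \<le> cmod (cell_factor (\<sigma> a)) * cmod (cell_factor (\<sigma> a * m))"
      by (intro mult_mono norm_cell_factor_ge) auto
    then have "cmod (trig_poly N z (\<sigma> a) (\<sigma> a * m)) * (1 / 2 * (1 / 2)) \<le> cmod (G a)"
      unfolding G_def fourier_slice_pixel_fun norm_mult mult.assoc by (intro mult_left_mono) auto
    then have "(cmod (trig_poly N z (\<sigma> a) (\<sigma> a * m)))\<^sup>2 \<le> (4 * cmod (G a))\<^sup>2"
      by (intro power_mono) auto
    then show ?thesis by (simp add: power_mult_distrib)
  qed
  then have "(\<Sum>a<3 * N. (cmod (trig_poly N z (\<sigma> a) (\<sigma> a * m)))\<^sup>2) \<le> (\<Sum>a<3 * N. 16 * (cmod (G a))\<^sup>2)"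
    by (intro sum_mono) auto
  also have "\<dots> \<le> 16 * (L\<^sup>2 * M\<^sup>2)"
  proof -
    have "\<sigma> a = (- 1 / 2 + \<tau> / L) + real a / L" for a
      by (simp add: \<sigma>_def L_def add_divide_distrib)
    then have "(\<Sum>a<3 * N. (cmod (G a))\<^sup>2) \<le> L\<^sup>2 * M\<^sup>2"
      unfolding G_def
      using bessel_period[OF L, of "shear_proj (pixel_fun N z) m" M "- real N" "- 1 / 2 + \<tau> / L" "3 * N"]
        shear_proj_pixel_fun_outside[OF m] bound
      by (simp add: L_def borel_measurable_shear_proj)
    then show ?thesis by (simp add: sum_distrib_left[symmetric])
  qed
  finally show ?thesis by (simp add: L_def power_mult_distrib)
qed

lemma borel_measurable_trig_poly [measurable (raw)]:
  assumes [measurable]: "f \<in> borel_measurable M" "g \<in> borel_measurable M"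
  shows "(\<lambda>x. trig_poly N z (f x) (g x)) \<in> borel_measurable M"
  unfolding trig_poly_def by measurable

text \<open>An integral is the integral over the translations \<open>\<tau>\<close> in a unit interval of sums over a lattice; this
is how the discrete inequality above becomes an integral bound.\<close>
lemma nn_integral_fold_unit:
  fixes F :: "real \<Rightarrow> ennreal"
  assumes [measurable]: "F \<in> borel_measurable borel"
  shows "(\<integral>\<^sup>+x. indicator {0..real n} x * F x \<partial>lborel) =
    (\<integral>\<^sup>+\<tau>. indicator {0..<1} \<tau> * (\<Sum>a<n. F (\<tau> + real a)) \<partial>lborel)"
proof -
  have "AE x in lborel. x \<noteq> real n"
    by (rule AE_lborel_singleton)
  then have "(\<integral>\<^sup>+x. indicator {0..real n} x * F x \<partial>lborel) =
      (\<integral>\<^sup>+x. indicator {0..<real n} x * F x \<partial>lborel)"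
    by (intro nn_integral_cong_AE) (auto simp: indicator_def)
  also have "\<dots> = (\<Sum>a<n. \<integral>\<^sup>+x. indicator {real a..<real a + 1} x * F x \<partial>lborel)"
  proof (induction n)
    case (Suc n)
    have "(\<integral>\<^sup>+x. indicator {0..<real (Suc n)} x * F x \<partial>lborel) =
        (\<integral>\<^sup>+x. indicator {0..<real n} x * F x + indicator {real n..<real n + 1} x * F x \<partial>lborel)"
      by (intro nn_integral_cong) (auto simp: indicator_def)
    also have "\<dots> = (\<integral>\<^sup>+x. indicator {0..<real n} x * F x \<partial>lborel) +
        (\<integral>\<^sup>+x. indicator {real n..<real n + 1} x * F x \<partial>lborel)"
      by (rule nn_integral_add) measurable
    finally show ?case
      using Suc.IH by simp
  qed simp
  also have "\<dots> = (\<Sum>a<n. \<integral>\<^sup>+\<tau>. indicator {0..<1} \<tau> * F (\<tau> + real a) \<partial>lborel)"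
  proof (rule sum.cong[OF refl])
    fix a
    have "(\<integral>\<^sup>+x. indicator {real a..<real a + 1} x * F x \<partial>lborel) =
        (\<integral>\<^sup>+\<tau>. indicator {real a..<real a + 1} (real a + 1 * \<tau>) * F (real a + 1 * \<tau>) \<partial>lborel)"
      by (subst nn_integral_real_affine[where c=1 and t="real a"]) auto
    also have "\<dots> = (\<integral>\<^sup>+\<tau>. indicator {0..<1} \<tau> * F (\<tau> + real a) \<partial>lborel)"
      by (intro nn_integral_cong) (auto simp: indicator_def add.commute)
    finally show "(\<integral>\<^sup>+x. indicator {real a..<real a + 1} x * F x \<partial>lborel) =
        (\<integral>\<^sup>+\<tau>. indicator {0..<1} \<tau> * F (\<tau> + real a) \<partial>lborel)" .
  qed
  also have "\<dots> = (\<integral>\<^sup>+\<tau>. (\<Sum>a<n. indicator {0..<1} \<tau> * F (\<tau> + real a)) \<partial>lborel)"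
    by (rule nn_integral_sum[symmetric]) measurable
  finally show ?thesis
    by (simp add: sum_distrib_left)
qed

lemma nn_integral_trig_poly_on_ray_le:
  assumes N: "1 \<le> N" and m: "\<bar>m\<bar> \<le> 1"
    and bound: "\<And>s. cmod (shear_proj (pixel_fun N z) m s) \<le> M"
  shows "(\<integral>\<^sup>+\<sigma>. indicator {- 1 / 2..1 / 2} \<sigma> * ennreal ((cmod (trig_poly N z \<sigma> (\<sigma> * m)))\<^sup>2) \<partial>lborel)
    \<le> ennreal (48 * real N * M\<^sup>2)"
proof -
  define L where "L = real (3 * N)"
  have L: "L > 0" using N by (simp add: L_def)
  define H where "H x = ennreal ((cmod (trig_poly N z (- 1 / 2 + x / L) ((- 1 / 2 + x / L) * m)))\<^sup>2)" for x
  have [measurable]: "H \<in> borel_measurable borel"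
    unfolding H_def[abs_def] by measurable
  have "(\<integral>\<^sup>+\<sigma>. indicator {- 1 / 2..1 / 2} \<sigma> * ennreal ((cmod (trig_poly N z \<sigma> (\<sigma> * m)))\<^sup>2) \<partial>lborel) =
      ennreal (1 / L) * (\<integral>\<^sup>+x. indicator {- 1 / 2..1 / 2} (- 1 / 2 + 1 / L * x) *
        ennreal ((cmod (trig_poly N z (- 1 / 2 + 1 / L * x) ((- 1 / 2 + 1 / L * x) * m)))\<^sup>2) \<partial>lborel)"
    using L by (subst nn_integral_real_affine[where c="1 / L" and t="- 1 / 2"]) auto
  also have "\<dots> = ennreal (1 / L) * (\<integral>\<^sup>+x. indicator {0..real (3 * N)} x * H x \<partial>lborel)"
  proof -
    have "- 1 / 2 + 1 / L * x \<in> {- 1 / 2..1 / 2} \<longleftrightarrow> x \<in> {0..L}" for x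
      using L by (auto simp: field_simps)
    then show ?thesis
      unfolding L_def[symmetric]
      by (intro arg_cong2[where f="(*)"] refl nn_integral_cong) (simp_all add: H_def indicator_def)
  qed
  also have "\<dots> = ennreal (1 / L) * (\<integral>\<^sup>+\<tau>. indicator {0..<1} \<tau> * (\<Sum>a<3 * N. H (\<tau> + real a)) \<partial>lborel)"
    by (subst nn_integral_fold_unit) auto
  also have "\<dots> \<le> ennreal (1 / L) *
      (\<integral>\<^sup>+\<tau>. ennreal (144 * (real N)\<^sup>2 * M\<^sup>2) * indicator {0..<1} (\<tau>::real) \<partial>lborel)"
  proof (intro mult_left_mono nn_integral_mono)
    fix \<tau> :: real
    show "indicator {0..<1} \<tau> * (\<Sum>a<3 * N. H (\<tau> + real a)) \<le>
        ennreal (144 * (real N)\<^sup>2 * M\<^sup>2) * indicator {0..<1} \<tau>"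
      using sum_trig_poly_on_ray_le[OF N m _ _ bound, of \<tau>]
      by (auto simp: indicator_def H_def L_def intro: ennreal_leI)
  qed auto
  also have "\<dots> = ennreal (1 / L) * ennreal (144 * (real N)\<^sup>2 * M\<^sup>2)"
    by (simp add: nn_integral_cmult_indicator)
  also have "\<dots> = ennreal (1 / L * (144 * (real N)\<^sup>2 * M\<^sup>2))"
    by (rule ennreal_mult[symmetric]) (use L in auto)
  also have "1 / L * (144 * (real N)\<^sup>2 * M\<^sup>2) = 48 * real N * M\<^sup>2"
    using N by (simp add: L_def power2_eq_square)
  finally show ?thesis .
qed

section \<open>The two cones of directions\<close>

text \<open>The substitution \<open>\<beta> = \<alpha> m\<close> turns the cone into the rays of slope \<open>\<bar>m\<bar> \<le> 1\<close>; its Jacobian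
\<open>\<bar>\<alpha>\<bar>\<close> is at most \<open>1/2\<close>, and the interval of slopes has length \<open>2\<close>. The slope \<open>m = 0\<close> is a null
set and is left out of the hypothesis because a line parallel to an axis can run along an edge of the
square.\<close>
lemma nn_integral_trig_poly_on_cone_le:
  assumes N: "1 \<le> N"
    and bound: "\<And>m s. m \<noteq> 0 \<Longrightarrow> \<bar>m\<bar> \<le> 1 \<Longrightarrow> cmod (shear_proj (pixel_fun N z) m s) \<le> M"
  shows "(\<integral>\<^sup>+\<alpha>. \<integral>\<^sup>+\<beta>. (if \<bar>\<alpha>\<bar> \<le> 1 / 2 \<and> \<bar>\<beta>\<bar> \<le> \<bar>\<alpha>\<bar> then ennreal ((cmod (trig_poly N z \<alpha> \<beta>))\<^sup>2) else 0)
      \<partial>lborel \<partial>lborel) \<le> ennreal (48 * real N * M\<^sup>2)"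
proof -
  define W where "W \<alpha> \<beta> = ennreal ((cmod (trig_poly N z \<alpha> \<beta>))\<^sup>2)" for \<alpha> \<beta>
  have inner: "(\<integral>\<^sup>+\<beta>. (if \<bar>\<alpha>\<bar> \<le> 1 / 2 \<and> \<bar>\<beta>\<bar> \<le> \<bar>\<alpha>\<bar> then W \<alpha> \<beta> else 0) \<partial>lborel) \<le>
      ennreal (1 / 2) * (\<integral>\<^sup>+m. indicator {- 1..1} m * (indicator {- 1 / 2..1 / 2} \<alpha> * W \<alpha> (\<alpha> * m)) \<partial>lborel)"
    if "\<alpha> \<noteq> 0" for \<alpha>
  proof (cases "\<bar>\<alpha>\<bar> \<le> 1 / 2")
    case True
    have "(\<integral>\<^sup>+\<beta>. (if \<bar>\<alpha>\<bar> \<le> 1 / 2 \<and> \<bar>\<beta>\<bar> \<le> \<bar>\<alpha>\<bar> then W \<alpha> \<beta> else 0) \<partial>lborel) =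
        ennreal \<bar>\<alpha>\<bar> * (\<integral>\<^sup>+m. (if \<bar>\<alpha>\<bar> \<le> 1 / 2 \<and> \<bar>0 + \<alpha> * m\<bar> \<le> \<bar>\<alpha>\<bar> then W \<alpha> (0 + \<alpha> * m) else 0) \<partial>lborel)"
      by (rule nn_integral_real_affine[OF _ that]) (unfold W_def, measurable)
    also have "\<dots> = ennreal \<bar>\<alpha>\<bar> *
        (\<integral>\<^sup>+m. indicator {- 1..1} m * (indicator {- 1 / 2..1 / 2} \<alpha> * W \<alpha> (\<alpha> * m)) \<partial>lborel)"
      using that True
      by (intro arg_cong2[where f="(*)"] refl nn_integral_cong)
         (auto simp: indicator_def abs_mult abs_le_iff)
    also have "\<dots> \<le> ennreal (1 / 2) *
        (\<integral>\<^sup>+m. indicator {- 1..1} m * (indicator {- 1 / 2..1 / 2} \<alpha> * W \<alpha> (\<alpha> * m)) \<partial>lborel)"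
      using True by (intro mult_right_mono ennreal_leI) auto
    finally show ?thesis .
  qed simp
  have ray: "indicator {- 1..1} m * (\<integral>\<^sup>+\<alpha>. indicator {- 1 / 2..1 / 2} \<alpha> * W \<alpha> (\<alpha> * m) \<partial>lborel) \<le>
      ennreal (48 * real N * M\<^sup>2) * indicator {- 1..1} m" if "m \<noteq> 0" for m
    using nn_integral_trig_poly_on_ray_le[OF N, of m z M] bound[OF that]
    by (cases "\<bar>m\<bar> \<le> 1") (auto simp: W_def indicator_def)
  have nonzero: "AE x in lborel. x \<noteq> (0::real)"
    by (rule AE_lborel_singleton)
  have "(\<integral>\<^sup>+\<alpha>. \<integral>\<^sup>+\<beta>. (if \<bar>\<alpha>\<bar> \<le> 1 / 2 \<and> \<bar>\<beta>\<bar> \<le> \<bar>\<alpha>\<bar> then W \<alpha> \<beta> else 0) \<partial>lborel \<partial>lborel) \<le>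
      (\<integral>\<^sup>+\<alpha>. ennreal (1 / 2) *
        (\<integral>\<^sup>+m. indicator {- 1..1} m * (indicator {- 1 / 2..1 / 2} \<alpha> * W \<alpha> (\<alpha> * m)) \<partial>lborel) \<partial>lborel)"
    by (intro nn_integral_mono_AE eventually_mono[OF nonzero] inner)
  also have "\<dots> = ennreal (1 / 2) *
      (\<integral>\<^sup>+\<alpha>. \<integral>\<^sup>+m. indicator {- 1..1} m * (indicator {- 1 / 2..1 / 2} \<alpha> * W \<alpha> (\<alpha> * m)) \<partial>lborel \<partial>lborel)"
    by (rule nn_integral_cmult) (unfold W_def, measurable)
  also have "\<dots> = ennreal (1 / 2) *
      (\<integral>\<^sup>+m. \<integral>\<^sup>+\<alpha>. indicator {- 1..1} m * (indicator {- 1 / 2..1 / 2} \<alpha> * W \<alpha> (\<alpha> * m)) \<partial>lborel \<partial>lborel)"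
    by (subst lborel_pair.Fubini') (unfold W_def, measurable)
  also have "\<dots> = ennreal (1 / 2) *
      (\<integral>\<^sup>+m. indicator {- 1..1} m * (\<integral>\<^sup>+\<alpha>. indicator {- 1 / 2..1 / 2} \<alpha> * W \<alpha> (\<alpha> * m) \<partial>lborel) \<partial>lborel)"
    by (subst nn_integral_cmult) (unfold W_def, measurable)
  also have "\<dots> \<le> ennreal (1 / 2) *
      (\<integral>\<^sup>+m. ennreal (48 * real N * M\<^sup>2) * indicator {- 1..1} (m::real) \<partial>lborel)"
    by (intro mult_left_mono nn_integral_mono_AE eventually_mono[OF nonzero] ray) simp_all
  also have "\<dots> = ennreal (1 / 2) * (ennreal (48 * real N * M\<^sup>2) * ennreal (1 - (- 1)))"
    by (subst nn_integral_cmult_indicator) simp_all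
  also have "\<dots> = ennreal (1 / 2 * (48 * real N * M\<^sup>2 * (1 - (- 1))))"
    by (simp only: ennreal_mult' ennreal_mult'' zero_le_mult_iff zero_le_power2 of_nat_0_le_iff)
  also have "1 / 2 * (48 * real N * M\<^sup>2 * (1 - (- 1))) = 48 * real N * M\<^sup>2"
    by simp
  finally show ?thesis
    unfolding W_def .
qed

lemma nn_parseval_unit:
  "(\<integral>\<^sup>+s. ennreal (indicator {- 1 / 2..1 / 2} s * (cmod (\<Sum>a<n. c a * phase (real a * s)))\<^sup>2) \<partial>lborel) =
    ennreal (\<Sum>a<n. (cmod (c a))\<^sup>2)"
  using parseval_period[of 1 "- 1 / 2" c n]
  by (subst nn_integral_eq_integral) (auto simp: has_bochner_integral_iff)

text \<open>One-dimensional Parseval in \<open>\<beta>\<close> for every fixed \<open>\<alpha>\<close>, and then in \<open>\<alpha>\<close> for every coefficient.\<close>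
lemma nn_parseval_square:
  "(\<integral>\<^sup>+\<alpha>. \<integral>\<^sup>+\<beta>. ennreal (indicator {- 1 / 2..1 / 2} \<alpha> * (indicator {- 1 / 2..1 / 2} \<beta> *
      (cmod (trig_poly N z \<alpha> \<beta>))\<^sup>2)) \<partial>lborel \<partial>lborel) =
    ennreal (\<Sum>i<N. \<Sum>j<N. (cmod (z i j))\<^sup>2)"
proof -
  define c where "c \<alpha> j = (\<Sum>i<N. z i j * phase (real i * \<alpha>))" for \<alpha> j
  have [measurable]: "(\<lambda>\<alpha>. c \<alpha> j) \<in> borel_measurable borel" for j
    unfolding c_def by measurable
  have "trig_poly N z \<alpha> \<beta> = (\<Sum>j<N. c \<alpha> j * phase (real j * \<beta>))" for \<alpha> \<beta>
    unfolding trig_poly_def c_def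
    by (subst sum.swap) (simp add: phase_add sum_distrib_left mult_ac)
  then have "(\<integral>\<^sup>+\<beta>. ennreal (indicator {- 1 / 2..1 / 2} \<alpha> * (indicator {- 1 / 2..1 / 2} \<beta> *
      (cmod (trig_poly N z \<alpha> \<beta>))\<^sup>2)) \<partial>lborel) =
      (\<Sum>j<N. ennreal (indicator {- 1 / 2..1 / 2} \<alpha> * (cmod (c \<alpha> j))\<^sup>2))" for \<alpha>
    using nn_parseval_unit[of "c \<alpha>" N] by (auto simp: indicator_def)
  then have "(\<integral>\<^sup>+\<alpha>. \<integral>\<^sup>+\<beta>. ennreal (indicator {- 1 / 2..1 / 2} \<alpha> * (indicator {- 1 / 2..1 / 2} \<beta> *
      (cmod (trig_poly N z \<alpha> \<beta>))\<^sup>2)) \<partial>lborel \<partial>lborel) =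
      (\<integral>\<^sup>+\<alpha>. (\<Sum>j<N. ennreal (indicator {- 1 / 2..1 / 2} \<alpha> * (cmod (c \<alpha> j))\<^sup>2)) \<partial>lborel)"
    by (simp only:)
  also have "\<dots> = (\<Sum>j<N. \<integral>\<^sup>+\<alpha>. ennreal (indicator {- 1 / 2..1 / 2} \<alpha> * (cmod (c \<alpha> j))\<^sup>2) \<partial>lborel)"
    by (rule nn_integral_sum) measurable
  also have "\<dots> = ennreal (\<Sum>j<N. \<Sum>i<N. (cmod (z i j))\<^sup>2)"
    unfolding c_def nn_parseval_unit by (rule sum_ennreal) (simp add: sum_nonneg)
  finally show ?thesis
    by (subst sum.swap)
qed

text \<open>Transposing the coefficients exchanges the two frequency variables, so the cone bounds for \<open>z\<close> and for
its transpose together cover the whole frequency square.\<close>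
lemma sum_norm_pixels_le:
  assumes N: "1 \<le> N"
    and steep: "\<And>m s. m \<noteq> 0 \<Longrightarrow> \<bar>m\<bar> \<le> 1 \<Longrightarrow> cmod (shear_proj (pixel_fun N z) m s) \<le> M"
    and flat: "\<And>m s. m \<noteq> 0 \<Longrightarrow> \<bar>m\<bar> \<le> 1 \<Longrightarrow> cmod (shear_proj (pixel_fun N (\<lambda>i j. z j i)) m s) \<le> M"
  shows "(\<Sum>i<N. \<Sum>j<N. (cmod (z i j))\<^sup>2) \<le> 96 * real N * M\<^sup>2"
proof -
  define E where "E z \<alpha> \<beta> = ennreal ((cmod (trig_poly N z \<alpha> \<beta>))\<^sup>2)" for z \<alpha> \<beta>
  define D where "D z \<alpha> \<beta> = (if \<bar>\<alpha>\<bar> \<le> 1 / 2 \<and> \<bar>\<beta>\<bar> \<le> \<bar>\<alpha>\<bar> then E z \<alpha> \<beta> else 0)" for z and \<alpha> \<beta> :: real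
  define z' where "z' = (\<lambda>i j. z j i)"
  have D_pair [measurable]: "(\<lambda>(\<alpha>, \<beta>). D z \<alpha> \<beta>) \<in> borel_measurable (lborel \<Otimes>\<^sub>M lborel)"
    "(\<lambda>(\<alpha>, \<beta>). D z \<beta> \<alpha>) \<in> borel_measurable (lborel \<Otimes>\<^sub>M lborel)" for z
    unfolding D_def E_def by measurable
  have transpose: "E z \<alpha> \<beta> = E z' \<beta> \<alpha>" for \<alpha> \<beta>
  proof -
    have "trig_poly N z \<alpha> \<beta> = trig_poly N z' \<beta> \<alpha>"
      unfolding trig_poly_def z'_def by (subst sum.swap) (simp add: add.commute)
    then show ?thesis by (simp add: E_def)
  qed
  have "ennreal (\<Sum>i<N. \<Sum>j<N. (cmod (z i j))\<^sup>2) =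
      (\<integral>\<^sup>+\<alpha>. \<integral>\<^sup>+\<beta>. ennreal (indicator {- 1 / 2..1 / 2} \<alpha> * (indicator {- 1 / 2..1 / 2} \<beta> *
        (cmod (trig_poly N z \<alpha> \<beta>))\<^sup>2)) \<partial>lborel \<partial>lborel)"
    by (rule nn_parseval_square[symmetric])
  also have "\<dots> \<le> (\<integral>\<^sup>+\<alpha>. \<integral>\<^sup>+\<beta>. D z \<alpha> \<beta> + D z' \<beta> \<alpha> \<partial>lborel \<partial>lborel)"
  proof (intro nn_integral_mono)
    fix \<alpha> \<beta> :: real
    show "ennreal (indicator {- 1 / 2..1 / 2} \<alpha> * (indicator {- 1 / 2..1 / 2} \<beta> *
        (cmod (trig_poly N z \<alpha> \<beta>))\<^sup>2)) \<le> D z \<alpha> \<beta> + D z' \<beta> \<alpha>"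
    proof (cases "\<bar>\<alpha>\<bar> \<le> 1 / 2 \<and> \<bar>\<beta>\<bar> \<le> 1 / 2")
      case True
      then have "E z \<alpha> \<beta> \<le> D z \<alpha> \<beta> + D z' \<beta> \<alpha>"
        unfolding D_def by (cases "\<bar>\<beta>\<bar> \<le> \<bar>\<alpha>\<bar>") (auto simp: transpose)
      then show ?thesis by (auto simp: E_def indicator_def)
    qed (auto simp: indicator_def abs_le_iff)
  qed
  also have "\<dots> = (\<integral>\<^sup>+\<alpha>. (\<integral>\<^sup>+\<beta>. D z \<alpha> \<beta> \<partial>lborel) + (\<integral>\<^sup>+\<beta>. D z' \<beta> \<alpha> \<partial>lborel) \<partial>lborel)"
    by (intro nn_integral_cong nn_integral_add) (unfold D_def E_def, measurable)
  also have "\<dots> = (\<integral>\<^sup>+\<alpha>. \<integral>\<^sup>+\<beta>. D z \<alpha> \<beta> \<partial>lborel \<partial>lborel) + (\<integral>\<^sup>+\<alpha>. \<integral>\<^sup>+\<beta>. D z' \<beta> \<alpha> \<partial>lborel \<partial>lborel)"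
    by (rule nn_integral_add) measurable
  also have "(\<integral>\<^sup>+\<alpha>. \<integral>\<^sup>+\<beta>. D z' \<beta> \<alpha> \<partial>lborel \<partial>lborel) = (\<integral>\<^sup>+\<beta>. \<integral>\<^sup>+\<alpha>. D z' \<beta> \<alpha> \<partial>lborel \<partial>lborel)"
    by (rule lborel_pair.Fubini') measurable
  also have "(\<integral>\<^sup>+\<alpha>. \<integral>\<^sup>+\<beta>. D z \<alpha> \<beta> \<partial>lborel \<partial>lborel) + (\<integral>\<^sup>+\<beta>. \<integral>\<^sup>+\<alpha>. D z' \<beta> \<alpha> \<partial>lborel \<partial>lborel) \<le>
      ennreal (48 * real N * M\<^sup>2) + ennreal (48 * real N * M\<^sup>2)"
    unfolding D_def E_def z'_def
    by (intro add_mono nn_integral_trig_poly_on_cone_le N steep flat)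
  also have "\<dots> = ennreal (96 * real N * M\<^sup>2)"
    by (simp flip: ennreal_plus)
  finally show ?thesis
    by (subst (asm) ennreal_le_iff) auto
qed

section \<open>Line integrals by arc length\<close>

text \<open>A line that is not parallel to an axis meets each of the lines \<open>x = N\<close> and \<open>y = N\<close> in one point, so
the values of \<open>f\<close> on those edges do not matter.\<close>
lemma line_integral_eq_pixel_fun:
  assumes outside: "\<forall>p. p \<notin> {0..real N} \<times> {0..real N} \<longrightarrow> f p = 0"
    and cells: "\<forall>i<N. \<forall>j<N. \<forall>p \<in> {real i..<real i + 1} \<times> {real j..<real j + 1}. f p = z i j"
    and v: "fst v \<noteq> 0" "snd v \<noteq> 0"
  shows "line_integral (line_at p (v /\<^sub>R norm v)) f =
    norm v *\<^sub>R (LINT t|lborel. pixel_fun N z (p + t *\<^sub>R v))"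
proof -
  define X where "X = {(real N - fst p) / fst v, (real N - snd p) / snd v}"
  have off_edges: "f q = pixel_fun N z q" if "fst q \<noteq> real N" "snd q \<noteq> real N" for q
  proof (cases "q \<in> {0..<real N} \<times> {0..<real N}")
    case True
    then obtain i j where "i < N" "j < N" "q \<in> {real i..<real i + 1} \<times> {real j..<real j + 1}"
      using in_some_cell[of "fst q" N] in_some_cell[of "snd q" N] by (metis mem_Times_iff atLeastLessThan_iff)
    with cells show ?thesis
      by (metis pixel_fun_cell)
  next
    case False
    with that have "q \<notin> {0..real N} \<times> {0..real N}"
      by (auto simp: mem_Times_iff)
    with outside have "f q = 0"
      by blast
    with False show ?thesis
      by (simp add: pixel_fun_outside)
  qed
  have "norm v \<noteq> 0"
    using v by auto
  then have "line_integral (line_at p (v /\<^sub>R norm v)) f = (LINT t|lebesgue. f (p + t *\<^sub>R (v /\<^sub>R norm v)))"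
    by (intro line_integral_eq) simp
  also have "\<dots> = norm v *\<^sub>R (LINT t|lebesgue. f (p + (0 + norm v * t) *\<^sub>R (v /\<^sub>R norm v)))"
    using \<open>norm v \<noteq> 0\<close> by (subst lebesgue_integral_real_affine[where c="norm v" and t=0]) auto
  also have "\<dots> = norm v *\<^sub>R (LINT t|lebesgue. f (p + t *\<^sub>R v))"
  proof -
    have "(0 + norm v * t) *\<^sub>R (v /\<^sub>R norm v) = t *\<^sub>R v" for t
      using \<open>norm v \<noteq> 0\<close> by simp
    then show ?thesis by (simp only:)
  qed
  also have "(LINT t|lebesgue. f (p + t *\<^sub>R v)) = (LINT t|lebesgue. pixel_fun N z (p + t *\<^sub>R v))"
  proof (rule integral_discrete_difference[of X])
    fix t assume "t \<notin> X"
    then show "f (p + t *\<^sub>R v) = pixel_fun N z (p + t *\<^sub>R v)"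
      using v by (intro off_edges) (auto simp: X_def field_simps)
  qed (auto simp: X_def)
  also have "\<dots> = (LINT t|lborel. pixel_fun N z (p + t *\<^sub>R v))"
    by (rule integral_completion) measurable
  finally show ?thesis .
qed

theorem theorem2:
  shows "\<exists>C::real. C > 0 \<and>
    (\<forall>(N::nat) (z::nat \<Rightarrow> nat \<Rightarrow> complex) (f::real \<times> real \<Rightarrow> complex).
       N \<ge> 1 \<longrightarrow>
       (\<forall>p. p \<notin> {0..real N} \<times> {0..real N} \<longrightarrow> f p = 0) \<longrightarrow>
       (\<forall>i<N. \<forall>j<N. \<forall>p \<in> {real i..<real i + 1} \<times> {real j..<real j + 1}. f p = z i j) \<longrightarrow>
       (\<exists>S. straight_line S \<and>
          cmod (line_integral S f) \<ge>
            C * real N powr (- 1 / 2) * sqrt (\<Sum>i<N. \<Sum>j<N. (cmod (z i j))\<^sup>2)))"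
proof (intro exI[of _ "1 / 10"] conjI allI impI)
  fix N :: nat and z :: "nat \<Rightarrow> nat \<Rightarrow> complex" and f :: "real \<times> real \<Rightarrow> complex"
  assume N: "N \<ge> 1"
    and outside: "\<forall>p. p \<notin> {0..real N} \<times> {0..real N} \<longrightarrow> f p = 0"
    and cells: "\<forall>i<N. \<forall>j<N. \<forall>p \<in> {real i..<real i + 1} \<times> {real j..<real j + 1}. f p = z i j"
  define Q where "Q = (\<Sum>i<N. \<Sum>j<N. (cmod (z i j))\<^sup>2)"
  define M where "M = 1 / 10 * real N powr (- 1 / 2) * sqrt Q"
  have "Q \<ge> 0"
    by (simp add: Q_def sum_nonneg)
  have "(real N powr (- 1 / 2))\<^sup>2 = 1 / real N"
    using N by (simp add: power2_eq_square powr_minus_divide flip: powr_add)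
  then have M2: "M\<^sup>2 = Q / (100 * real N)"
    using \<open>Q \<ge> 0\<close> by (simp add: M_def power_mult_distrib power_divide)
  \<comment> \<open>The constant \<open>1/10\<close> works because \<open>96 * (1/10)^2 < 1\<close>.\<close>
  have "\<exists>S. straight_line S \<and> M \<le> cmod (line_integral S f)"
  proof (rule ccontr)
    assume none: "\<nexists>S. straight_line S \<and> M \<le> cmod (line_integral S f)"
    have small: "cmod (LINT t|lborel. pixel_fun N z (p + t *\<^sub>R v)) \<le> M" and pos: "0 < M"
      if v: "fst v \<noteq> 0" "snd v \<noteq> 0" "1 \<le> norm v" for p v
    proof -
      have "v \<noteq> 0"
        using v(1) by auto
      then have "norm (v /\<^sub>R norm v) = 1"
        by simp
      then have "straight_line (line_at p (v /\<^sub>R norm v))"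
        unfolding straight_line_def by blast
      with none have less: "norm v * cmod (LINT t|lborel. pixel_fun N z (p + t *\<^sub>R v)) < M"
        using line_integral_eq_pixel_fun[OF outside cells v(1,2), of p] by (force simp: not_le)
      have le: "1 * cmod (LINT t|lborel. pixel_fun N z (p + t *\<^sub>R v)) \<le>
          norm v * cmod (LINT t|lborel. pixel_fun N z (p + t *\<^sub>R v))"
        using v(3) by (rule mult_right_mono) simp
      from less le show "cmod (LINT t|lborel. pixel_fun N z (p + t *\<^sub>R v)) \<le> M" by linarith
      from less le show "0 < M" by (smt (verit) norm_ge_zero)
    qed
    have norm_ge: "1 \<le> norm v" if "\<bar>fst v\<bar> = 1 \<or> \<bar>snd v\<bar> = 1" for v :: "real \<times> real"
      using that norm_fst_le[of "fst v" "snd v"] norm_snd_le[of "snd v" "fst v"] by auto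
    \<comment> \<open>The directions \<open>(- m, 1)\<close> and \<open>(1, - m)\<close> belong to the two cones.\<close>
    have "Q \<le> 96 * real N * M\<^sup>2"
      unfolding Q_def
    proof (rule sum_norm_pixels_le[OF N])
      fix m s :: real assume "m \<noteq> 0"
      then show "cmod (shear_proj (pixel_fun N z) m s) \<le> M"
        using small[of "(- m, 1)" "(s, 0)"] norm_ge[of "(- m, 1)"]
        by (simp add: shear_proj_def mult.commute)
      have "pixel_fun N (\<lambda>i j. z j i) (x, y) = pixel_fun N z (y, x)" for x y
        unfolding pixel_fun_def by (subst sum.swap) (simp add: mult_ac)
      with \<open>m \<noteq> 0\<close> show "cmod (shear_proj (pixel_fun N (\<lambda>i j. z j i)) m s) \<le> M"
        using small[of "(1, - m)" "(0, s)"] norm_ge[of "(1, - m)"]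
        by (simp add: shear_proj_def mult.commute)
    qed
    also have "\<dots> = 96 / 100 * Q"
      using N by (simp add: M2)
    finally have "Q \<le> 0"
      by simp
    with \<open>Q \<ge> 0\<close> have "M = 0"
      by (simp add: M_def)
    \<comment> \<open>The case that all \<open>z i j\<close> vanish: every line has \<open>0 \<le> \<bar>line integral\<bar> < M\<close>.\<close>
    with pos[of "(1, 1)"] norm_ge[of "(1, 1)"] show False
      by simp
  qed
  then show "\<exists>S. straight_line S \<and> 1 / 10 * real N powr (- 1 / 2) *
      sqrt (\<Sum>i<N. \<Sum>j<N. (cmod (z i j))\<^sup>2) \<le> cmod (line_integral S f)"
    by (simp only: M_def Q_def)
qed simp

end
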